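(* Let $\alpha: I\subset\mathbb{R}\to\mathbf{E}^4$ be a unit speed curve in Euclidean 4-space with curvatures $\kappa_1,\kappa_2,\kappa_3$, all nowhere zero on $I$. Then $\alpha$ is a slant helix if and only if there exist an antiderivative $K=\int\kappa_1\,ds$ of $\kappa_1$ on $I$ and a $C^2$-function $f:I\to\mathbb{R}$ such that, for all $s\in I$, $$\kappa_3(s) f(s)=\left(\frac{\kappa_1}{\kappa_2}K\right)'(s)+\kappa_2(s),\qquad \frac{d}{ds}f(s)=-\frac{\kappa_3(s)\kappa_1(s)}{\kappa_2(s)}K(s).$$
   Context: $\mathbf{E}^4$ is $\mathbb{R}^4$ with the standard scalar product $\langle\cdot,\cdot\rangle$, and $I\subset\mathbb{R}$ is an open interval. A curve $\alpha:I\to\mathbf{E}^4$, assumed smooth, is of unit speed if $\langle\alpha'(s),\alpha'(s)\rangle=1$ for all $s\in I$. Its Frenet frame $\{\mathbf{T},\mathbf{N},\mathbf{B}_1,\mathbf{B}_2\}$ (tangent $\mathbf{T}=\alpha'$, principal normal, first binormal and second binormal) is an orthonormal frame along $\alpha$ satisfying $$\mathbf{T}'=\kappa_1\mathbf{N},\quad \mathbf{N}'=-\kappa_1\mathbf{T}+\kappa_2\mathbf{B}_1,\quad \mathbf{B}_1'=-\kappa_2\mathbf{N}+\kappa_3\mathbf{B}_2,\quad \mathbf{B}_2'=-\kappa_3\mathbf{B}_1,$$ where $\kappa_1,\kappa_2,\kappa_3: I\to\mathbb{R}$ are the first, second and third curvatures. Standing assumption: $\kappa_i(s)\neq 0$ for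 all $s\in I$ and $i=1,2,3$. The curve $\alpha$ is called a slant helix if its unit principal normal $\mathbf{N}$ makes a constant angle $\theta$ with a fixed direction $U$, i.e. there is a constant vector $U$, which may be taken of unit length, with $\langle\mathbf{N}(s),U\rangle=\cos\theta$ constant in $s\in I$. A prime denotes the derivative with respect to $s$.
   Formalization: The constant angle θ between N and U is required to differ from π/2 (cos θ ≠ 0); if θ = π/2 were allowed, "slant helix implies K, f exist" would fail, e.g. for κ₁ = cos s, κ₂ = κ₃ = 1 on (−1,1). *)

theory Defs
  imports "HOL-Analysis.Analysis"
begin

(* Intended for open S: the derivatives are two-sided. D j is the j-th derivative of g on S. *)
definition C_k_on :: "nat \<Rightarrow> (real \<Rightarrow> 'a::real_normed_vector) \<Rightarrow> real set \<Rightarrow> bool" where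
  "C_k_on k g S \<longleftrightarrow>
     (\<exists>D. D 0 = g \<and>
          (\<forall>j<k. \<forall>s\<in>S. (D j has_vector_derivative D (Suc j) s) (at s)) \<and>
          continuous_on S (D k))"

definition smooth_curve_on :: "(real \<Rightarrow> 'a::real_normed_vector) \<Rightarrow> real set \<Rightarrow> bool" where
  "smooth_curve_on g S \<longleftrightarrow> (\<forall>k. C_k_on k g S)"

definition unit_speed_on :: "(real \<Rightarrow> 'a::real_inner) \<Rightarrow> real set \<Rightarrow> bool" where
  "unit_speed_on \<alpha> S \<longleftrightarrow>
     (\<forall>s\<in>S. vector_derivative \<alpha> (at s) \<bullet> vector_derivative \<alpha> (at s) = 1)"

definition orthonormal4 :: "real^4 \<Rightarrow> real^4 \<Rightarrow> real^4 \<Rightarrow> real^4 \<Rightarrow> bool" where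
  "orthonormal4 a b c d \<longleftrightarrow>
     norm a = 1 \<and> norm b = 1 \<and> norm c = 1 \<and> norm d = 1 \<and>
     a \<bullet> b = 0 \<and> a \<bullet> c = 0 \<and> a \<bullet> d = 0 \<and> b \<bullet> c = 0 \<and> b \<bullet> d = 0 \<and> c \<bullet> d = 0"

(* No sign or orientation convention is imposed: the frame and the curvatures are data
   determined by the curve only up to signs. *)
definition frenet_frame_on ::
  "real set \<Rightarrow> (real \<Rightarrow> real^4) \<Rightarrow>
   (real \<Rightarrow> real^4) \<Rightarrow> (real \<Rightarrow> real^4) \<Rightarrow> (real \<Rightarrow> real^4) \<Rightarrow> (real \<Rightarrow> real^4) \<Rightarrow>
   (real \<Rightarrow> real) \<Rightarrow> (real \<Rightarrow> real) \<Rightarrow> (real \<Rightarrow> real) \<Rightarrow> bool" where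
  "frenet_frame_on S \<alpha> T N B\<^sub>1 B\<^sub>2 \<kappa>\<^sub>1 \<kappa>\<^sub>2 \<kappa>\<^sub>3 \<longleftrightarrow>
     (\<forall>s\<in>S. T s = vector_derivative \<alpha> (at s) \<and>
        orthonormal4 (T s) (N s) (B\<^sub>1 s) (B\<^sub>2 s) \<and>
        (T has_vector_derivative \<kappa>\<^sub>1 s *\<^sub>R N s) (at s) \<and>
        (N has_vector_derivative - \<kappa>\<^sub>1 s *\<^sub>R T s + \<kappa>\<^sub>2 s *\<^sub>R B\<^sub>1 s) (at s) \<and>
        (B\<^sub>1 has_vector_derivative - \<kappa>\<^sub>2 s *\<^sub>R N s + \<kappa>\<^sub>3 s *\<^sub>R B\<^sub>2 s) (at s) \<and>
        (B\<^sub>2 has_vector_derivative - \<kappa>\<^sub>3 s *\<^sub>R B\<^sub>1 s) (at s))"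

(* A curve with principal normal N is a slant helix with axis U and angle \<theta>. *)
definition slant_helix_on :: "real set \<Rightarrow> (real \<Rightarrow> real^4) \<Rightarrow> real^4 \<Rightarrow> real \<Rightarrow> bool" where
  "slant_helix_on S N U \<theta> \<longleftrightarrow>
     norm U = 1 \<and> 0 \<le> \<theta> \<and> \<theta> \<le> pi \<and> (\<forall>s\<in>S. N s \<bullet> U = cos \<theta>)"

end

theory Submission
  imports Defs
begin

text \<open>
  Let \<open>U\<close> be a fixed vector with \<open>N \<bullet> U = c\<close> constant, and write
  \<open>a = T \<bullet> U\<close>, \<open>b = B\<^sub>1 \<bullet> U\<close>, \<open>d = B\<^sub>2 \<bullet> U\<close> for its remaining frame
  coordinates. The Frenet equations turn into
  \<open>a' = \<kappa>\<^sub>1 c\<close>, \<open>\<kappa>\<^sub>1 a = \<kappa>\<^sub>2 b\<close>, \<open>b' = - \<kappa>\<^sub>2 c + \<kappa>\<^sub>3 d\<close>, \<open>d' = - \<kappa>\<^sub>3 b\<close>.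
  If \<open>c \<noteq> 0\<close>, dividing by \<open>c\<close> shows that \<open>K = a / c\<close> is an antiderivative of
  \<open>\<kappa>\<^sub>1\<close>, that \<open>b / c = (\<kappa>\<^sub>1 / \<kappa>\<^sub>2) K\<close>, and that \<open>f = d / c\<close> solves the two
  equations for \<open>f\<close>. Conversely, these equations say exactly that the vector field
  \<open>K T + N + (\<kappa>\<^sub>1 / \<kappa>\<^sub>2) K B\<^sub>1 + f B\<^sub>2\<close> has zero derivative; it is then a
  constant vector whose product with \<open>N\<close> is \<open>1\<close>, and normalising it gives the axis.

  Regularity is where the smoothness of the curve enters: \<open>f\<close> has to be \<open>C\<^sup>2\<close>, and
  \<open>(\<kappa>\<^sub>1 / \<kappa>\<^sub>2) K\<close> has to be differentiable for its \<open>deriv\<close> to mean anything,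
  whereas the frame is only given as differentiable and the curvatures as bare functions. Each
  Frenet equation has the form \<open>V = \<kappa> W\<close> with \<open>V\<close> already known to be smooth, \<open>W\<close> a
  differentiable unit field and \<open>\<kappa>\<close> nowhere zero. Lemma \<open>smooth_curve_on_factor\<close> deduces
  that \<open>\<kappa>\<close> and \<open>W\<close> are smooth, and \<open>frenet_frame_smooth\<close> applies it three times.
\<close>

section \<open>Calculus of \<open>C\<^sup>k\<close> functions on an open set\<close>

lemma C_k_on_0 [simp]: "C_k_on 0 g S \<longleftrightarrow> continuous_on S g"
  unfolding C_k_on_def by auto

text \<open>
  This recursive description replaces the sequence of derivatives by a single one, so that the
  closure properties below become inductions on the order.
\<close>

lemma C_k_on_Suc:
  "C_k_on (Suc k) g S \<longleftrightarrow>
     (\<exists>g'. (\<forall>s\<in>S. (g has_vector_derivative g' s) (at s)) \<and> C_k_on k g' S)"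
proof
  assume "C_k_on (Suc k) g S"
  then obtain D where D: "D 0 = g"
      "\<forall>j<Suc k. \<forall>s\<in>S. (D j has_vector_derivative D (Suc j) s) (at s)"
      "continuous_on S (D (Suc k))"
    unfolding C_k_on_def by blast
  have "C_k_on k (D 1) S"
    unfolding C_k_on_def by (rule exI[of _ "\<lambda>j. D (Suc j)"]) (use D in auto)
  moreover have "\<forall>s\<in>S. (g has_vector_derivative D 1 s) (at s)"
    using D by auto
  ultimately show "\<exists>g'. (\<forall>s\<in>S. (g has_vector_derivative g' s) (at s)) \<and> C_k_on k g' S"
    by blast
next
  assume "\<exists>g'. (\<forall>s\<in>S. (g has_vector_derivative g' s) (at s)) \<and> C_k_on k g' S"
  then obtain g' D where g': "\<forall>s\<in>S. (g has_vector_derivative g' s) (at s)"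
    and D: "D 0 = g'" "\<forall>j<k. \<forall>s\<in>S. (D j has_vector_derivative D (Suc j) s) (at s)"
      "continuous_on S (D k)"
    unfolding C_k_on_def by blast
  show "C_k_on (Suc k) g S"
    unfolding C_k_on_def
    by (rule exI[of _ "case_nat g D"]) (use g' D in \<open>auto split: nat.split\<close>)
qed

lemma has_vector_derivative_imp_continuous_on:
  assumes "\<forall>s\<in>S. (g has_vector_derivative g' s) (at s)"
  shows "continuous_on S g"
  using assms
  by (meson continuous_at_imp_continuous_on has_vector_derivative_continuous)

lemma C_k_on_SucD: "C_k_on (Suc k) g S \<Longrightarrow> C_k_on k g S"
proof (induction k arbitrary: g)
  case 0
  then show ?case
    by (auto simp: C_k_on_Suc intro: has_vector_derivative_imp_continuous_on)
next
  case (Suc k)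
  obtain g' where "\<forall>s\<in>S. (g has_vector_derivative g' s) (at s)" "C_k_on (Suc k) g' S"
    using Suc.prems C_k_on_Suc[of "Suc k"] by blast
  then show ?case
    using Suc.IH C_k_on_Suc[of k] by blast
qed

lemma C_k_on_cong:
  assumes "open S" "C_k_on k g S" "\<And>s. s \<in> S \<Longrightarrow> g s = h s"
  shows "C_k_on k h S"
proof (cases k)
  case 0
  then show ?thesis
    using assms continuous_on_cong[of S S g h] by simp
next
  case (Suc n)
  obtain g' where "\<forall>s\<in>S. (g has_vector_derivative g' s) (at s)" "C_k_on n g' S"
    using assms(2) unfolding Suc C_k_on_Suc by blast
  then show ?thesis
    unfolding Suc C_k_on_Suc
    using has_vector_derivative_transform_within_open[of g _ _ S h] assms(1,3) by blast
qed

lemma C_k_on_const: "C_k_on k (\<lambda>s. c) S"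
proof (induction k arbitrary: c)
  case (Suc k)
  then show ?case
    unfolding C_k_on_Suc by (intro exI[of _ "\<lambda>s. 0"]) auto
qed simp

lemma C_k_on_add:
  "C_k_on k g S \<Longrightarrow> C_k_on k h S \<Longrightarrow> C_k_on k (\<lambda>s. g s + h s) S"
proof (induction k arbitrary: g h)
  case 0
  then show ?case by (simp add: continuous_on_add)
next
  case (Suc k)
  then obtain g' h' where "\<forall>s\<in>S. (g has_vector_derivative g' s) (at s)" "C_k_on k g' S"
    "\<forall>s\<in>S. (h has_vector_derivative h' s) (at s)" "C_k_on k h' S"
    unfolding C_k_on_Suc by blast
  then show ?case
    unfolding C_k_on_Suc
    by (intro exI[of _ "\<lambda>s. g' s + h' s"]) (simp add: Suc.IH has_vector_derivative_add)
qed

lemma (in bounded_bilinear) C_k_on: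
  "C_k_on k g S \<Longrightarrow> C_k_on k h S \<Longrightarrow> C_k_on k (\<lambda>s. prod (g s) (h s)) S"
proof (induction k arbitrary: g h)
  case 0
  then show ?case by (auto intro: continuous_on)
next
  case (Suc k)
  then obtain g' h' where "\<forall>s\<in>S. (g has_vector_derivative g' s) (at s)" "C_k_on k g' S"
    "\<forall>s\<in>S. (h has_vector_derivative h' s) (at s)" "C_k_on k h' S"
    unfolding C_k_on_Suc by blast
  moreover have "C_k_on k g S" "C_k_on k h S"
    using Suc.prems by (auto dest: C_k_on_SucD)
  ultimately show ?case
    unfolding C_k_on_Suc
    by (intro exI[of _ "\<lambda>s. prod (g s) (h' s) + prod (g' s) (h s)"])
       (simp add: Suc.IH C_k_on_add has_vector_derivative)
qed

lemma C_k_on_inverse: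
  fixes g :: "real \<Rightarrow> real"
  assumes "C_k_on k g S" and nz: "\<forall>s\<in>S. g s \<noteq> 0"
  shows "C_k_on k (\<lambda>s. inverse (g s)) S"
  using assms(1)
proof (induction k)
  case 0
  then show ?case using nz by (simp add: continuous_on_inverse)
next
  case (Suc k)
  then obtain g' where g': "\<forall>s\<in>S. (g has_vector_derivative g' s) (at s)" "C_k_on k g' S"
    unfolding C_k_on_Suc by blast
  have inv: "C_k_on k (\<lambda>s. inverse (g s)) S"
    using Suc by (auto dest: C_k_on_SucD)
  have "\<forall>s\<in>S. ((\<lambda>s. inverse (g s)) has_vector_derivative
      (-1) * (inverse (g s) * (g' s * inverse (g s)))) (at s)"
    using DERIV_inverse'[of g "g' s" s UNIV for s] g'(1) nz
    by (simp add: has_real_derivative_iff_has_vector_derivative mult.assoc)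
  moreover have "C_k_on k (\<lambda>s. (-1) * (inverse (g s) * (g' s * inverse (g s)))) S"
    using inv g'(2) by (intro bounded_bilinear.C_k_on[OF bounded_bilinear_mult] C_k_on_const)
  ultimately show ?case
    unfolding C_k_on_Suc by (intro exI conjI)
qed

section \<open>Smooth curves\<close>

lemma smooth_curve_on_const: "smooth_curve_on (\<lambda>s. c) S"
  by (simp add: smooth_curve_on_def C_k_on_const)

lemma smooth_curve_on_add:
  "smooth_curve_on g S \<Longrightarrow> smooth_curve_on h S \<Longrightarrow> smooth_curve_on (\<lambda>s. g s + h s) S"
  by (simp add: smooth_curve_on_def C_k_on_add)

lemma (in bounded_bilinear) smooth_curve_on:
  "smooth_curve_on g S \<Longrightarrow> smooth_curve_on h S \<Longrightarrow> smooth_curve_on (\<lambda>s. prod (g s) (h s)) S"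
  by (simp add: smooth_curve_on_def C_k_on)

lemma smooth_curve_on_cong:
  "open S \<Longrightarrow> smooth_curve_on g S \<Longrightarrow> (\<And>s. s \<in> S \<Longrightarrow> g s = h s) \<Longrightarrow> smooth_curve_on h S"
  unfolding smooth_curve_on_def using C_k_on_cong by blast

lemma smooth_curve_on_has_vector_derivative:
  assumes "smooth_curve_on g S" "s \<in> S"
  shows "(g has_vector_derivative vector_derivative g (at s)) (at s)"
proof -
  have "C_k_on (Suc 0) g S"
    using assms(1) by (simp only: smooth_curve_on_def)
  then show ?thesis
    using assms(2) unfolding C_k_on_Suc by (auto simp: vector_derivative_at)
qed

lemma smooth_curve_on_vector_derivative:
  assumes "open S" "smooth_curve_on g S"
  shows "smooth_curve_on (\<lambda>s. vector_derivative g (at s)) S"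
  unfolding smooth_curve_on_def
proof
  fix k
  have "C_k_on (Suc k) g S"
    using assms(2) by (simp only: smooth_curve_on_def)
  then obtain g' where "\<forall>s\<in>S. (g has_vector_derivative g' s) (at s)" "C_k_on k g' S"
    unfolding C_k_on_Suc by blast
  then show "C_k_on k (\<lambda>s. vector_derivative g (at s)) S"
    by (elim C_k_on_cong[OF assms(1)]) (simp add: vector_derivative_at[symmetric])
qed

lemma smooth_curve_on_derivative:
  assumes "open S" "smooth_curve_on g S"
    and "\<And>s. s \<in> S \<Longrightarrow> (g has_vector_derivative g' s) (at s)"
  shows "smooth_curve_on g' S"
  using smooth_curve_on_vector_derivative[OF assms(1,2)]
  by (rule smooth_curve_on_cong[OF assms(1)]) (simp add: vector_derivative_at[OF assms(3)])

lemma unit_field_orthogonal_derivative: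
  fixes W :: "real \<Rightarrow> 'a::real_inner"
  assumes "open S" "s \<in> S" "\<And>t. t \<in> S \<Longrightarrow> norm (W t) = 1"
    and "(W has_vector_derivative w) (at s)"
  shows "W s \<bullet> w = 0"
proof -
  have "((\<lambda>t. W t \<bullet> W t) has_vector_derivative W s \<bullet> w + w \<bullet> W s) (at s)"
    by (rule bounded_bilinear.has_vector_derivative[OF bounded_bilinear_inner assms(4,4)])
  moreover have "((\<lambda>t. W t \<bullet> W t) has_vector_derivative 0) (at s)"
    by (rule has_vector_derivative_transform_within_open[of "\<lambda>t. 1::real" _ _ S])
       (use assms in \<open>auto simp: dot_square_norm\<close>)
  ultimately have "W s \<bullet> w + w \<bullet> W s = 0"
    using vector_derivative_unique_at by blast
  then show ?thesis
    by (simp add: inner_commute)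
qed

text \<open>
  The proof bootstraps. Since \<open>\<kappa> = V \<bullet> W\<close> and \<open>W'\<close> is orthogonal to \<open>W\<close>, hence to \<open>V\<close>,
  the derivative \<open>\<kappa>' = V' \<bullet> W\<close> does not involve \<open>W'\<close>. So if \<open>W\<close> is \<open>C\<^sup>k\<close>, then \<open>\<kappa>\<close> is
  one order better, and so is \<open>W = V / \<kappa>\<close>.
\<close>

lemma smooth_curve_on_factor:
  fixes W :: "real \<Rightarrow> 'a::real_inner"
  assumes S: "open S" and V: "smooth_curve_on V S"
    and VW: "\<And>s. s \<in> S \<Longrightarrow> V s = \<kappa> s *\<^sub>R W s"
    and nz: "\<And>s. s \<in> S \<Longrightarrow> \<kappa> s \<noteq> 0"
    and unit: "\<And>s. s \<in> S \<Longrightarrow> norm (W s) = 1"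
    and W: "\<And>s. s \<in> S \<Longrightarrow> (W has_vector_derivative W' s) (at s)"
  shows "smooth_curve_on \<kappa> S" "smooth_curve_on W S"
proof -
  define V' where "V' s = vector_derivative V (at s)" for s
  have V': "smooth_curve_on V' S"
    using smooth_curve_on_vector_derivative[OF S V] by (simp add: V'_def[abs_def])
  have \<kappa>_eq: "V s \<bullet> W s = \<kappa> s" if "s \<in> S" for s
    using unit[OF that] by (simp add: VW[OF that] dot_square_norm)
  have d\<kappa>: "(\<kappa> has_vector_derivative V' s \<bullet> W s) (at s)" if s: "s \<in> S" for s
  proof -
    have "((\<lambda>t. V t \<bullet> W t) has_vector_derivative V s \<bullet> W' s + V' s \<bullet> W s) (at s)"
      unfolding V'_def
      by (rule bounded_bilinear.has_vector_derivative[OF bounded_bilinear_inner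
            smooth_curve_on_has_vector_derivative[OF V s] W[OF s]])
    moreover have "V s \<bullet> W' s = 0"
      using unit_field_orthogonal_derivative[OF S s unit W[OF s]] by (simp add: VW[OF s])
    ultimately have "((\<lambda>t. V t \<bullet> W t) has_vector_derivative V' s \<bullet> W s) (at s)"
      by simp
    then show ?thesis
      by (rule has_vector_derivative_transform_within_open[OF _ S s]) (rule \<kappa>_eq)
  qed
  have gain: "C_k_on (Suc k) \<kappa> S" if "C_k_on k W S" for k
  proof -
    have "C_k_on k (\<lambda>s. V' s \<bullet> W s) S"
      using V' that unfolding smooth_curve_on_def
      by (intro bounded_bilinear.C_k_on[OF bounded_bilinear_inner]) simp_all
    then show ?thesis
      unfolding C_k_on_Suc using d\<kappa>
      by (intro exI[of _ "\<lambda>s. V' s \<bullet> W s"]) simp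
  qed
  have Wk: "C_k_on k W S" for k
  proof (induction k)
    case 0
    show ?case
      using W by (auto intro: has_vector_derivative_imp_continuous_on)
  next
    case (Suc k)
    have "C_k_on (Suc k) (\<lambda>s. inverse (\<kappa> s) *\<^sub>R V s) S"
      using V gain[OF Suc] nz unfolding smooth_curve_on_def
      by (intro bounded_bilinear.C_k_on[OF bounded_bilinear_scaleR] C_k_on_inverse) auto
    then show ?case
      by (rule C_k_on_cong[OF S]) (use VW nz in auto)
  qed
  then show "smooth_curve_on W S"
    by (simp add: smooth_curve_on_def)
  show "smooth_curve_on \<kappa> S"
    by (simp add: smooth_curve_on_def C_k_on_SucD[OF gain[OF Wk]])
qed

section \<open>Regularity of the Frenet apparatus\<close>

lemma frenet_frame_onD:
  assumes "frenet_frame_on S \<alpha> T N B\<^sub>1 B\<^sub>2 \<kappa>\<^sub>1 \<kappa>\<^sub>2 \<kappa>\<^sub>3" "s \<in> S"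
  shows "(T has_vector_derivative \<kappa>\<^sub>1 s *\<^sub>R N s) (at s)"
    and "(N has_vector_derivative - \<kappa>\<^sub>1 s *\<^sub>R T s + \<kappa>\<^sub>2 s *\<^sub>R B\<^sub>1 s) (at s)"
    and "(B\<^sub>1 has_vector_derivative - \<kappa>\<^sub>2 s *\<^sub>R N s + \<kappa>\<^sub>3 s *\<^sub>R B\<^sub>2 s) (at s)"
    and "(B\<^sub>2 has_vector_derivative - \<kappa>\<^sub>3 s *\<^sub>R B\<^sub>1 s) (at s)"
    and "norm (N s) = 1" "norm (B\<^sub>1 s) = 1" "norm (B\<^sub>2 s) = 1"
    and "T s \<bullet> N s = 0" "N s \<bullet> B\<^sub>1 s = 0" "N s \<bullet> B\<^sub>2 s = 0"
  using assms unfolding frenet_frame_on_def orthonormal4_def by blast+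

text \<open>
  Differentiating a smooth frame vector and removing the component along its predecessor leaves
  a curvature times the next frame vector, so smoothness passes from \<open>T\<close> along the frame.
\<close>

lemma frenet_frame_smooth:
  assumes S: "open S" and \<alpha>: "smooth_curve_on \<alpha> S"
    and F: "frenet_frame_on S \<alpha> T N B\<^sub>1 B\<^sub>2 \<kappa>\<^sub>1 \<kappa>\<^sub>2 \<kappa>\<^sub>3"
    and nz: "\<forall>s\<in>S. \<kappa>\<^sub>1 s \<noteq> 0 \<and> \<kappa>\<^sub>2 s \<noteq> 0 \<and> \<kappa>\<^sub>3 s \<noteq> 0"
  shows "smooth_curve_on \<kappa>\<^sub>1 S" "smooth_curve_on \<kappa>\<^sub>2 S" "smooth_curve_on B\<^sub>2 S"
proof -
  note F' = frenet_frame_onD[OF F]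
  note scale = bounded_bilinear.smooth_curve_on[OF bounded_bilinear_scaleR]
  have T: "smooth_curve_on T S"
    by (rule smooth_curve_on_cong[OF S smooth_curve_on_vector_derivative[OF S \<alpha>]])
       (use F in \<open>simp add: frenet_frame_on_def\<close>)
  have "smooth_curve_on (\<lambda>s. \<kappa>\<^sub>1 s *\<^sub>R N s) S"
    by (rule smooth_curve_on_derivative[OF S T]) (use F' in auto)
  note N = smooth_curve_on_factor[OF S this refl,
      of "\<lambda>s. - \<kappa>\<^sub>1 s *\<^sub>R T s + \<kappa>\<^sub>2 s *\<^sub>R B\<^sub>1 s"]
  have \<kappa>1: "smooth_curve_on \<kappa>\<^sub>1 S" and N: "smooth_curve_on N S"
    by (rule N; use F' nz in auto)+
  have "smooth_curve_on (\<lambda>s. - \<kappa>\<^sub>1 s *\<^sub>R T s + \<kappa>\<^sub>2 s *\<^sub>R B\<^sub>1 s) S"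
    by (rule smooth_curve_on_derivative[OF S N]) (use F' in auto)
  from smooth_curve_on_add[OF this scale[OF \<kappa>1 T]]
  have "smooth_curve_on (\<lambda>s. \<kappa>\<^sub>2 s *\<^sub>R B\<^sub>1 s) S"
    by simp
  note B1 = smooth_curve_on_factor[OF S this refl,
      of "\<lambda>s. - \<kappa>\<^sub>2 s *\<^sub>R N s + \<kappa>\<^sub>3 s *\<^sub>R B\<^sub>2 s"]
  have \<kappa>2: "smooth_curve_on \<kappa>\<^sub>2 S" and B1: "smooth_curve_on B\<^sub>1 S"
    by (rule B1; use F' nz in auto)+
  have "smooth_curve_on (\<lambda>s. - \<kappa>\<^sub>2 s *\<^sub>R N s + \<kappa>\<^sub>3 s *\<^sub>R B\<^sub>2 s) S"
    by (rule smooth_curve_on_derivative[OF S B1]) (use F' in auto)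
  from smooth_curve_on_add[OF this scale[OF \<kappa>2 N]]
  have "smooth_curve_on (\<lambda>s. \<kappa>\<^sub>3 s *\<^sub>R B\<^sub>2 s) S"
    by simp
  note B2 = smooth_curve_on_factor[OF S this refl, of "\<lambda>s. - \<kappa>\<^sub>3 s *\<^sub>R B\<^sub>1 s"]
  show "smooth_curve_on B\<^sub>2 S"
    by (rule B2; use F' nz in auto)
  show "smooth_curve_on \<kappa>\<^sub>1 S" "smooth_curve_on \<kappa>\<^sub>2 S"
    by (rule \<kappa>1 \<kappa>2)+
qed

section \<open>The characterisation of slant helices\<close>

text \<open>
  An axis that is not orthogonal to \<open>N\<close> can be rescaled to have coordinate \<open>1\<close> along \<open>N\<close>. The
  field below has the other coordinates that are then forced on a constant vector: the
  hypotheses are precisely the vanishing of the four frame coordinates of its derivative.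
\<close>

lemma frenet_axis_field_constant:
  assumes S: "open S" "is_interval S"
    and F: "frenet_frame_on S \<alpha> T N B\<^sub>1 B\<^sub>2 \<kappa>\<^sub>1 \<kappa>\<^sub>2 \<kappa>\<^sub>3"
    and K: "\<And>s. s \<in> S \<Longrightarrow> (K has_real_derivative \<kappa>\<^sub>1 s) (at s)"
    and h: "\<And>s. s \<in> S \<Longrightarrow> (h has_real_derivative \<kappa>\<^sub>3 s * f s - \<kappa>\<^sub>2 s) (at s)"
    and f: "\<And>s. s \<in> S \<Longrightarrow> (f has_real_derivative - \<kappa>\<^sub>3 s * h s) (at s)"
    and Kh: "\<And>s. s \<in> S \<Longrightarrow> \<kappa>\<^sub>1 s * K s = \<kappa>\<^sub>2 s * h s"
  shows "\<exists>W. \<forall>s\<in>S. K s *\<^sub>R T s + N s + h s *\<^sub>R B\<^sub>1 s + f s *\<^sub>R B\<^sub>2 s = W"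
proof -
  have d: "((\<lambda>s. K s *\<^sub>R T s + N s + h s *\<^sub>R B\<^sub>1 s + f s *\<^sub>R B\<^sub>2 s)
      has_vector_derivative 0) (at s)" if s: "s \<in> S" for s
  proof -
    note F' = frenet_frame_onD[OF F s]
    have "((\<lambda>s. K s *\<^sub>R T s + N s + h s *\<^sub>R B\<^sub>1 s + f s *\<^sub>R B\<^sub>2 s) has_vector_derivative
        (K s *\<^sub>R (\<kappa>\<^sub>1 s *\<^sub>R N s) + \<kappa>\<^sub>1 s *\<^sub>R T s)
        + (- \<kappa>\<^sub>1 s *\<^sub>R T s + \<kappa>\<^sub>2 s *\<^sub>R B\<^sub>1 s)
        + (h s *\<^sub>R (- \<kappa>\<^sub>2 s *\<^sub>R N s + \<kappa>\<^sub>3 s *\<^sub>R B\<^sub>2 s) + (\<kappa>\<^sub>3 s * f s - \<kappa>\<^sub>2 s) *\<^sub>R B\<^sub>1 s)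
        + (f s *\<^sub>R (- \<kappa>\<^sub>3 s *\<^sub>R B\<^sub>1 s) + (- \<kappa>\<^sub>3 s * h s) *\<^sub>R B\<^sub>2 s)) (at s)"
      by (intro has_vector_derivative_add has_vector_derivative_scaleR K[OF s] h[OF s] f[OF s])
         (use F' in auto)
    also have "(K s *\<^sub>R (\<kappa>\<^sub>1 s *\<^sub>R N s) + \<kappa>\<^sub>1 s *\<^sub>R T s)
        + (- \<kappa>\<^sub>1 s *\<^sub>R T s + \<kappa>\<^sub>2 s *\<^sub>R B\<^sub>1 s)
        + (h s *\<^sub>R (- \<kappa>\<^sub>2 s *\<^sub>R N s + \<kappa>\<^sub>3 s *\<^sub>R B\<^sub>2 s) + (\<kappa>\<^sub>3 s * f s - \<kappa>\<^sub>2 s) *\<^sub>R B\<^sub>1 s)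
        + (f s *\<^sub>R (- \<kappa>\<^sub>3 s *\<^sub>R B\<^sub>1 s) + (- \<kappa>\<^sub>3 s * h s) *\<^sub>R B\<^sub>2 s)
        = (\<kappa>\<^sub>1 s * K s - \<kappa>\<^sub>2 s * h s) *\<^sub>R N s"
      by (simp add: algebra_simps)
    finally show ?thesis
      by (simp add: Kh[OF s])
  qed
  have "convex S"
    using S(2) by (simp add: is_interval_convex)
  then obtain W where
    "\<And>s. s \<in> S \<Longrightarrow> K s *\<^sub>R T s + N s + h s *\<^sub>R B\<^sub>1 s + f s *\<^sub>R B\<^sub>2 s = W"
    using has_vector_derivative_zero_constant[OF _ has_vector_derivative_at_within[OF d]]
    by metis
  then show ?thesis
    by blast
qed

theorem theorem3p1:
  fixes I :: "real set"
    and \<alpha> T N B\<^sub>1 B\<^sub>2 :: "real \<Rightarrow> real^4"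
    and \<kappa>\<^sub>1 \<kappa>\<^sub>2 \<kappa>\<^sub>3 :: "real \<Rightarrow> real"
  assumes "open I" and "is_interval I" and "I \<noteq> {}"
    and "smooth_curve_on \<alpha> I"
    and "unit_speed_on \<alpha> I"
    and "frenet_frame_on I \<alpha> T N B\<^sub>1 B\<^sub>2 \<kappa>\<^sub>1 \<kappa>\<^sub>2 \<kappa>\<^sub>3"
    and "\<forall>s\<in>I. \<kappa>\<^sub>1 s \<noteq> 0 \<and> \<kappa>\<^sub>2 s \<noteq> 0 \<and> \<kappa>\<^sub>3 s \<noteq> 0"
  shows "(\<exists>U \<theta>. \<theta> \<noteq> pi / 2 \<and> slant_helix_on I N U \<theta>) \<longleftrightarrow>
    (\<exists>K f :: real \<Rightarrow> real.
       (\<forall>s\<in>I. (K has_real_derivative \<kappa>\<^sub>1 s) (at s)) \<and>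
       C_k_on 2 f I \<and>
       (\<forall>s\<in>I. \<kappa>\<^sub>3 s * f s = deriv (\<lambda>t. \<kappa>\<^sub>1 t / \<kappa>\<^sub>2 t * K t) s + \<kappa>\<^sub>2 s \<and>
              (f has_real_derivative - (\<kappa>\<^sub>3 s * \<kappa>\<^sub>1 s / \<kappa>\<^sub>2 s) * K s) (at s)))"
proof -
  note F = frenet_frame_onD[OF assms(6)]
  note nz = assms(7)[rule_format]
  note smooth = frenet_frame_smooth[OF assms(1,4,6,7)]
  show ?thesis
  proof
    assume "\<exists>U \<theta>. \<theta> \<noteq> pi / 2 \<and> slant_helix_on I N U \<theta>"
    then obtain U \<theta> where U: "\<theta> \<noteq> pi / 2" "0 \<le> \<theta>" "\<theta> \<le> pi"
        "\<And>s. s \<in> I \<Longrightarrow> N s \<bullet> U = cos \<theta>"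
      unfolding slant_helix_on_def by blast
    define c where "c = cos \<theta>"
    have c: "c \<noteq> 0"
      using U(1-3) cos_inj_pi[of \<theta> "pi / 2"] by (auto simp: c_def)
    have coord: "((\<lambda>t. X t \<bullet> U / c) has_real_derivative x \<bullet> U / c) (at s)"
      if "(X has_vector_derivative x) (at s)" for X :: "real \<Rightarrow> real^4" and x s
      unfolding has_real_derivative_iff_has_vector_derivative divide_inverse
      by (intro has_vector_derivative_mult_left
            bounded_linear.has_vector_derivative[OF bounded_linear_inner_left that])
    define K where "K = (\<lambda>s. T s \<bullet> U / c)"
    define f where "f = (\<lambda>s. B\<^sub>2 s \<bullet> U / c)"
    have NU: "N s \<bullet> U = c" if "s \<in> I" for s
      using U(4)[OF that] by (simp add: c_def)
    have K: "(K has_real_derivative \<kappa>\<^sub>1 s) (at s)" if "s \<in> I" for s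
      using coord[of T "\<kappa>\<^sub>1 s *\<^sub>R N s" s] F[OF that] NU[OF that] c by (simp add: K_def)
    have b: "\<kappa>\<^sub>1 s / \<kappa>\<^sub>2 s * K s = B\<^sub>1 s \<bullet> U / c" if s: "s \<in> I" for s
    proof -
      have "((\<lambda>t. N t \<bullet> U / c) has_real_derivative
          (- \<kappa>\<^sub>1 s *\<^sub>R T s + \<kappa>\<^sub>2 s *\<^sub>R B\<^sub>1 s) \<bullet> U / c) (at s)"
        using F[OF s] by (intro coord) simp
      moreover have "((\<lambda>t. N t \<bullet> U / c) has_real_derivative 0) (at s)"
        by (rule has_field_derivative_transform_within_open[of "\<lambda>t. 1" _ _ I])
           (use s assms(1) NU c in auto)
      ultimately have "(- \<kappa>\<^sub>1 s *\<^sub>R T s + \<kappa>\<^sub>2 s *\<^sub>R B\<^sub>1 s) \<bullet> U / c = 0"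
        by (rule DERIV_unique)
      then have "\<kappa>\<^sub>1 s * (T s \<bullet> U) = \<kappa>\<^sub>2 s * (B\<^sub>1 s \<bullet> U)"
        using c by (simp add: inner_add_left inner_diff_left)
      then show ?thesis
        using nz[OF s] c by (simp add: K_def field_simps)
    qed
    have h: "\<kappa>\<^sub>3 s * f s = deriv (\<lambda>t. \<kappa>\<^sub>1 t / \<kappa>\<^sub>2 t * K t) s + \<kappa>\<^sub>2 s" if s: "s \<in> I" for s
    proof -
      have "((\<lambda>t. B\<^sub>1 t \<bullet> U / c) has_real_derivative
          (- \<kappa>\<^sub>2 s *\<^sub>R N s + \<kappa>\<^sub>3 s *\<^sub>R B\<^sub>2 s) \<bullet> U / c) (at s)"
        using F[OF s] by (intro coord) simp
      then have "((\<lambda>t. \<kappa>\<^sub>1 t / \<kappa>\<^sub>2 t * K t) has_real_derivative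
          (- \<kappa>\<^sub>2 s *\<^sub>R N s + \<kappa>\<^sub>3 s *\<^sub>R B\<^sub>2 s) \<bullet> U / c) (at s)"
        by (rule has_field_derivative_transform_within_open[OF _ assms(1) s]) (rule b[symmetric])
      then show ?thesis
        using NU[OF s] c by (simp add: DERIV_imp_deriv f_def inner_add_left inner_diff_left field_simps)
    qed
    have f: "(f has_real_derivative - (\<kappa>\<^sub>3 s * \<kappa>\<^sub>1 s / \<kappa>\<^sub>2 s) * K s) (at s)"
      if s: "s \<in> I" for s
    proof -
      have "(f has_real_derivative (- \<kappa>\<^sub>3 s *\<^sub>R B\<^sub>1 s) \<bullet> U / c) (at s)"
        unfolding f_def using F[OF s] by (intro coord) simp
      also have "(- \<kappa>\<^sub>3 s *\<^sub>R B\<^sub>1 s) \<bullet> U / c = - \<kappa>\<^sub>3 s * (\<kappa>\<^sub>1 s / \<kappa>\<^sub>2 s * K s)"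
        unfolding b[OF s] by simp
      also have "\<dots> = - (\<kappa>\<^sub>3 s * \<kappa>\<^sub>1 s / \<kappa>\<^sub>2 s) * K s"
        by simp
      finally show ?thesis .
    qed
    have "smooth_curve_on (\<lambda>s. B\<^sub>2 s \<bullet> ((1 / c) *\<^sub>R U)) I"
      using smooth(3)
      by (rule bounded_bilinear.smooth_curve_on[OF bounded_bilinear_inner _
            smooth_curve_on_const])
    then have "C_k_on 2 f I"
      by (simp add: smooth_curve_on_def f_def)
    with K h f show "\<exists>K f. (\<forall>s\<in>I. (K has_real_derivative \<kappa>\<^sub>1 s) (at s)) \<and> C_k_on 2 f I \<and>
        (\<forall>s\<in>I. \<kappa>\<^sub>3 s * f s = deriv (\<lambda>t. \<kappa>\<^sub>1 t / \<kappa>\<^sub>2 t * K t) s + \<kappa>\<^sub>2 s \<and>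
          (f has_real_derivative - (\<kappa>\<^sub>3 s * \<kappa>\<^sub>1 s / \<kappa>\<^sub>2 s) * K s) (at s))"
      by blast
  next
    assume "\<exists>K f. (\<forall>s\<in>I. (K has_real_derivative \<kappa>\<^sub>1 s) (at s)) \<and> C_k_on 2 f I \<and>
        (\<forall>s\<in>I. \<kappa>\<^sub>3 s * f s = deriv (\<lambda>t. \<kappa>\<^sub>1 t / \<kappa>\<^sub>2 t * K t) s + \<kappa>\<^sub>2 s \<and>
          (f has_real_derivative - (\<kappa>\<^sub>3 s * \<kappa>\<^sub>1 s / \<kappa>\<^sub>2 s) * K s) (at s))"
    then obtain K f where K: "\<And>s. s \<in> I \<Longrightarrow> (K has_real_derivative \<kappa>\<^sub>1 s) (at s)"
      and h: "\<And>s. s \<in> I \<Longrightarrow> \<kappa>\<^sub>3 s * f s = deriv (\<lambda>t. \<kappa>\<^sub>1 t / \<kappa>\<^sub>2 t * K t) s + \<kappa>\<^sub>2 s"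
      and f: "\<And>s. s \<in> I \<Longrightarrow>
        (f has_real_derivative - (\<kappa>\<^sub>3 s * \<kappa>\<^sub>1 s / \<kappa>\<^sub>2 s) * K s) (at s)"
      by blast
    define H where "H = (\<lambda>t. \<kappa>\<^sub>1 t / \<kappa>\<^sub>2 t * K t)"
    \<comment> \<open>The hypothesis speaks of \<open>deriv\<close>, which determines a derivative only because the
      curvatures are differentiable.\<close>
    have H: "(H has_real_derivative \<kappa>\<^sub>3 s * f s - \<kappa>\<^sub>2 s) (at s)" if s: "s \<in> I" for s
    proof -
      have "\<kappa>\<^sub>1 differentiable at s" "\<kappa>\<^sub>2 differentiable at s"
        using smooth(1,2) s
        by (auto dest: smooth_curve_on_has_vector_derivative intro: differentiableI_vector)
      moreover have "K differentiable at s"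
        using K[OF s] by (auto simp: real_differentiable_def)
      ultimately have "H differentiable at s"
        unfolding H_def using nz[OF s] by (intro derivative_intros) auto
      then have "(H has_real_derivative deriv H s) (at s)"
        by (simp add: DERIV_deriv_iff_real_differentiable)
      moreover have "deriv H s = \<kappa>\<^sub>3 s * f s - \<kappa>\<^sub>2 s"
        using h[OF s] by (simp add: H_def)
      ultimately show ?thesis
        by simp
    qed
    have "\<exists>W. \<forall>s\<in>I. K s *\<^sub>R T s + N s + H s *\<^sub>R B\<^sub>1 s + f s *\<^sub>R B\<^sub>2 s = W"
    proof (rule frenet_axis_field_constant[OF assms(1,2,6) K H])
      fix s assume s: "s \<in> I"
      show "(f has_real_derivative - \<kappa>\<^sub>3 s * H s) (at s)"
        using f[OF s] by (simp add: H_def mult.assoc)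
      show "\<kappa>\<^sub>1 s * K s = \<kappa>\<^sub>2 s * H s"
        using nz[OF s] by (simp add: H_def)
    qed
    then obtain W where W: "\<And>s. s \<in> I \<Longrightarrow>
        K s *\<^sub>R T s + N s + H s *\<^sub>R B\<^sub>1 s + f s *\<^sub>R B\<^sub>2 s = W"
      by blast
    have NW: "N s \<bullet> W = 1" if s: "s \<in> I" for s
      using F[OF s] unfolding W[OF s, symmetric]
      by (simp add: inner_add_right inner_commute dot_square_norm)
    obtain s where s: "s \<in> I"
      using assms(3) by blast
    \<comment> \<open>Cauchy-Schwarz makes \<open>W\<close> nonzero and puts \<open>1 / norm W\<close> in the domain of \<open>arccos\<close>.\<close>
    have W1: "norm W \<ge> 1"
      using norm_cauchy_schwarz[of "N s" W] NW[OF s] F[OF s] by simp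
    define \<theta> where "\<theta> = arccos (1 / norm W)"
    have "-1 \<le> 1 / norm W" "1 / norm W \<le> 1"
      using W1 by (simp_all add: divide_le_eq order_trans[of "-1" 0])
    then have \<theta>: "0 \<le> \<theta>" "\<theta> \<le> pi" "cos \<theta> = 1 / norm W"
      unfolding \<theta>_def by (auto simp: arccos_lbound arccos_ubound cos_arccos)
    have "\<theta> \<noteq> pi / 2"
    proof
      assume "\<theta> = pi / 2"
      then have "1 / norm W = 0"
        using \<theta>(3) cos_pi_half by metis
      then show False
        using W1 by simp
    qed
    moreover have "slant_helix_on I N ((1 / norm W) *\<^sub>R W) \<theta>"
      unfolding slant_helix_on_def using \<theta> W1 NW by auto
    ultimately show "\<exists>U \<theta>. \<theta> \<noteq> pi / 2 \<and> slant_helix_on I N U \<theta>"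
      by blast
  qed
qed

end
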